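(* Let $f:\mathbb{R}\to\mathbb{R}$ be continuous with $f(0)=0$ and $xf(x)>0$ for all $x\neq 0$. Suppose that there exists an odd function $\phi$ on $\mathbb{R}$ such that $\lim_{x\to 0} f(x)/\phi(x)=1$, that $f\in \mathrm{RV}_0(\beta)$ for some $\beta>1$, and that $\lim_{x\to 0^+} f(x)/x=0$. Let $g:[0,\infty)\to\mathbb{R}$ be continuous, and let $x$ be a continuous solution on $[0,\infty)$ of $$x'(t)=-f(x(t))+g(t),\quad t>0;\qquad x(0)=\xi\in\mathbb{R},$$ which obeys $\lim_{t\to\infty}x(t)=0$. Then the following are equivalent: (a) $$\lim_{t\to\infty}\frac{g(t)}{f(F^{-1}(t))}=0;$$ (b) there exists $\lambda\in\{-1,0,1\}$ such that $$\lim_{t\to\infty}\frac{x(t)}{F^{-1}(t)}=\lambda,\qquad \lim_{t\to\infty}\frac{x'(t)}{f(F^{-1}(t))}=-\lambda.$$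
   Context: A function $f$ which is positive and measurable on $(0,\infty)$ is regularly varying at $0$ with index $\beta\in\mathbb{R}$, written $f\in\mathrm{RV}_0(\beta)$, if $\lim_{x\to0^+} f(\lambda x)/f(x)=\lambda^\beta$ for every $\lambda>0$ (for $f$ defined on $\mathbb{R}$ this refers to its restriction to $(0,\infty)$). Define $F(x)=\int_x^1 \frac{1}{f(u)}\,du$ for $x>0$. $F$ is strictly decreasing; since $\beta>1$, $F(x)\to\infty$ as $x\to0^+$. $F^{-1}$ denotes the inverse function of $F$; $F^{-1}(t)>0$ is defined for all $t\ge 0$ and tends to $0$ as $t\to\infty$. *)

theory Defs
  imports "HOL-Analysis.Analysis"
begin

text \<open>Only the restriction of \<^term>\<open>f\<close> to \<open>(0, \<infinity>)\<close> matters.\<close>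

definition regularly_varying_at_0 :: "real \<Rightarrow> (real \<Rightarrow> real) \<Rightarrow> bool" where
  "regularly_varying_at_0 \<beta> f \<longleftrightarrow>
     (\<forall>x>0. f x > 0) \<and>
     f \<in> borel_measurable (lebesgue_on {0<..}) \<and>
     (\<forall>c>0. ((\<lambda>x. f (c * x) / f x) \<longlongrightarrow> c powr \<beta>) (at_right 0))"

text \<open>
  The function \<open>F(x) = \<integral>\<^sub>x\<^sup>1 du / f(u)\<close>, meaningful for \<open>x > 0\<close>. The integral is oriented:
  it is negative for \<open>x > 1\<close> if \<^term>\<open>f\<close> is positive.
\<close>

definition recip_integral :: "(real \<Rightarrow> real) \<Rightarrow> real \<Rightarrow> real" where
  "recip_integral f x = (LBINT u=ereal x..ereal 1. 1 / f u)"

text \<open>The inverse of \<open>F\<close> as a function on \<open>(0, \<infinity>)\<close>; the values of the total function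
  \<^term>\<open>recip_integral f\<close> at nonpositive arguments are disregarded.\<close>

definition recip_integral_inv :: "(real \<Rightarrow> real) \<Rightarrow> real \<Rightarrow> real" where
  "recip_integral_inv f = inv_into {0<..} (recip_integral f)"

end

theory Submission
  imports Defs
begin

text \<open>
  Let \<open>y = F\<^sup>-\<^sup>1\<close>. Since \<open>F' = -1/f\<close>, the function \<open>y\<close> is itself a positive solution of the
  unperturbed equation \<open>y' = -f(y)\<close>, and it decays to \<open>0\<close>. The proof studies the
  quotient \<open>z = x/y\<close>, which satisfies
  \<open>z' = w (z - f(z y) / f(y) + e)\<close> with \<open>w = f(y)/y = (- ln y)'\<close> and \<open>e = g / f(y)\<close>.
  In the new time \<open>- ln y\<close>, which runs to infinity, this is a perturbation of the autonomous
  equation \<open>z' = z - sgn(z) \<bar>z\<bar>\<^sup>\<beta>\<close>, because regular variation and asymptotic oddness make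
  \<open>f(z y) / f(y)\<close> approach \<open>sgn(z) \<bar>z\<bar>\<^sup>\<beta>\<close> as \<open>y\<close> tends to \<open>0\<close>. As \<open>\<beta> > 1\<close>, the equilibria
  \<open>1\<close> and \<open>-1\<close> are attracting and \<open>0\<close> is repelling, so under (a), that is when \<open>e\<close> tends to
  \<open>0\<close>, every solution converges to one of the three: a solution that keeps returning above some
  \<open>l > 0\<close> is pushed up to \<open>1\<close> and cannot come back, symmetrically for \<open>-1\<close>, and otherwise it
  tends to \<open>0\<close> (\<open>perturbed_flow_dichotomy\<close>, applied to \<open>z\<close> and to \<open>-z\<close>).

  Convergence of \<open>f(z y) / f(y)\<close> for fixed \<open>z\<close> does not give the sign of the drift along a
  solution, where \<open>z\<close> varies and is not known to be bounded. Uniform bounds come from a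
  quantitative form of the statement that \<open>f(v)/v\<close>, which varies regularly with the positive index \<open>\<beta> - 1\<close>, is almost
  increasing near \<open>0\<close>: if \<open>v \<ge> (1 + \<eta>) u\<close>, then \<open>f(v)/v \<ge> q f(u)/u\<close> for some \<open>q > 1\<close> that
  depends on \<open>\<eta>\<close> but not on \<open>u\<close> and \<open>v\<close> (\<open>superlinear_regularly_varying_quotient\<close>).
  It rests on the local uniformity of the limit that defines regular variation, which for continuous \<open>f\<close> is a consequence of the Baire
  category theorem (\<open>additive_limit_locally_uniform\<close>).

  The relation between \<open>x\<close>, \<open>x'\<close> and \<open>g\<close> is then algebraic: \<open>x'/f(y) = - f(x)/f(y) + g/f(y)\<close>, and
  \<open>x/y \<rightarrow> c\<close> with \<open>c \<in> {-1, 0, 1}\<close> forces \<open>f(x)/f(y) \<rightarrow> c\<close> (\<open>regularly_varying_ratio_limit\<close>). This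
  gives (a) from (b), and the second limit in (b) from the first.
\<close>

section \<open>Regular variation of continuous functions at zero\<close>

text \<open>
  The substitution \<open>x = exp (- u)\<close> turns regular variation at \<open>0\<close> into convergence of the
  increments of \<open>k u = - ln (f (exp (- u)))\<close>. For a fixed tolerance, the sets of
  shifts \<open>s\<close> for which the limit is attained from time \<open>n\<close> on are closed by continuity and exhaust the line, so by Baire one of them contains
  an interval. The difference of two shifts from that interval is an arbitrary small shift.
\<close>

lemma additive_limit_locally_uniform:
  fixes k :: "real \<Rightarrow> real"
  assumes cont: "continuous_on UNIV k"
    and lim: "\<And>s. ((\<lambda>u. k (u + s) - k u) \<longlongrightarrow> a * s) at_top"
    and "\<epsilon> > 0"
  obtains \<delta> U where "\<delta> > 0"
    "\<And>u s. U \<le> u \<Longrightarrow> 0 \<le> s \<Longrightarrow> s \<le> \<delta> \<Longrightarrow> \<bar>k (u + s) - k u\<bar> \<le> \<epsilon>"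
proof -
  define E where "E n = {s. \<forall>u\<ge>real n. \<bar>k (u + s) - k u - a * s\<bar> \<le> \<epsilon> / 4}" for n :: nat
  have closed_E: "closed (E n)" for n
    unfolding E_def
    by (intro closed_Collect_all closed_Collect_imp open_Collect_const closed_Collect_le
        continuous_intros continuous_on_compose2[OF cont]) auto
  have E_cover: "\<Union> (range E) = UNIV"
  proof -
    have "\<exists>n. s \<in> E n" for s
    proof -
      have "\<forall>\<^sub>F u in at_top. dist (k (u + s) - k u) (a * s) < \<epsilon> / 4"
        using lim[of s] \<open>\<epsilon> > 0\<close> by (intro tendstoD) auto
      then obtain N where N: "\<And>u. u \<ge> N \<Longrightarrow> dist (k (u + s) - k u) (a * s) < \<epsilon> / 4"
        by (auto simp: eventually_at_top_linorder)
      have "s \<in> E (nat \<lceil>N\<rceil>)"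
        unfolding E_def
      proof (intro CollectI allI impI)
        fix u assume "u \<ge> real (nat \<lceil>N\<rceil>)"
        hence "u \<ge> N" by linarith
        from N[OF this] show "\<bar>k (u + s) - k u - a * s\<bar> \<le> \<epsilon> / 4"
          by (simp add: dist_real_def)
      qed
      thus ?thesis ..
    qed
    thus ?thesis by auto
  qed
  have "\<exists>n. interior (E n) \<noteq> {}"
  proof (rule ccontr)
    assume "\<nexists>n. interior (E n) \<noteq> {}"
    hence "euclidean interior_of \<Union> (range E) = {}"
      using closed_E
      by (intro Baire_category_alt)
        (auto simp: completely_metrizable_space_euclidean euclidean_interior_of)
    thus False by (simp add: E_cover euclidean_interior_of)
  qed
  then obtain n c where "c \<in> interior (E n)" by blast
  then obtain r where r: "r > 0" "ball c r \<subseteq> E n"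
    by (auto simp: mem_interior)
  define \<delta> where "\<delta> = min (r / 2) (\<epsilon> / (2 * (\<bar>a\<bar> + 1)))"
  show thesis
  proof
    show "\<delta> > 0" using r \<open>\<epsilon> > 0\<close> by (simp add: \<delta>_def add_nonneg_pos)
  next
    fix u s assume u: "real n + c \<le> u" and s: "0 \<le> s" "s \<le> \<delta>"
    \<comment> \<open>Compare the increments by \<open>c + s\<close> and by \<open>c\<close>, both started at \<open>u - c\<close>.\<close>
    have "c + s \<in> E n" "c \<in> E n"
      using r s by (auto simp: \<delta>_def dist_real_def subset_iff)
    moreover have "u - c \<ge> real n" using u by simp
    ultimately have bounds: "\<bar>k (u - c + (c + s)) - k (u - c) - a * (c + s)\<bar> \<le> \<epsilon> / 4"
      "\<bar>k (u - c + c) - k (u - c) - a * c\<bar> \<le> \<epsilon> / 4"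
      unfolding E_def by blast+
    have eqs: "u - c + (c + s) = u + s" "u - c + c = u" "a * (c + s) = a * c + a * s"
      by (simp_all add: algebra_simps)
    have "\<bar>k (u + s) - k u - a * s\<bar> \<le> \<epsilon> / 2"
      using bounds[unfolded eqs] by linarith
    moreover have "\<bar>a * s\<bar> \<le> \<epsilon> / 2"
    proof -
      have "s \<le> \<epsilon> / (2 * (\<bar>a\<bar> + 1))" using s by (simp add: \<delta>_def)
      hence "\<bar>a * s\<bar> \<le> (\<bar>a\<bar> + 1) * (\<epsilon> / (2 * (\<bar>a\<bar> + 1)))"
        using s \<open>\<epsilon> > 0\<close> unfolding abs_mult by (intro mult_mono) auto
      also have "\<dots> = \<epsilon> / 2" by (simp add: field_simps add_nonneg_eq_0_iff)
      finally show ?thesis .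
    qed
    ultimately show "\<bar>k (u + s) - k u\<bar> \<le> \<epsilon>" by linarith
  qed
qed

text \<open>
  A sufficiently small fixed step \<open>h\<close> eventually raises \<open>k\<close> by at least \<open>a * h / 2\<close>, and many such
  steps add up. The remainder, shorter than \<open>h\<close>, is controlled by local uniformity. Thus the gain is
  uniform over all \<open>v\<close> beyond \<open>u + \<sigma>\<close>, however far away.
\<close>

lemma additive_limit_almost_increasing:
  fixes k :: "real \<Rightarrow> real"
  assumes cont: "continuous_on UNIV k"
    and lim: "\<And>s. ((\<lambda>u. k (u + s) - k u) \<longlongrightarrow> a * s) at_top"
    and "a > 0" "\<sigma> > 0"
  obtains c U where "c > 0" "\<And>u v. U \<le> u \<Longrightarrow> u + \<sigma> \<le> v \<Longrightarrow> k u + c \<le> k v"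
proof -
  define \<epsilon> where "\<epsilon> = a * \<sigma> / 8"
  have "\<epsilon> > 0" using assms by (simp add: \<epsilon>_def)
  obtain \<delta> U where \<delta>: "\<delta> > 0"
    and U: "\<And>u s. U \<le> u \<Longrightarrow> 0 \<le> s \<Longrightarrow> s \<le> \<delta> \<Longrightarrow> \<bar>k (u + s) - k u\<bar> \<le> \<epsilon>"
    using additive_limit_locally_uniform[OF cont lim \<open>\<epsilon> > 0\<close>] by metis
  \<comment> \<open>The step \<open>h\<close> divides \<open>\<sigma>\<close> and is so small that a remainder below \<open>h\<close> costs at most \<open>\<epsilon>\<close>.\<close>
  define M where "M = Suc (nat \<lceil>\<sigma> / \<delta>\<rceil>)"
  define h where "h = \<sigma> / real M"
  have "M > 0" by (simp add: M_def)
  have "real M \<ge> \<sigma> / \<delta>" unfolding M_def by linarith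
  hence h: "h > 0" "h \<le> \<delta>" "real M * h = \<sigma>"
    using \<open>\<sigma> > 0\<close> \<open>M > 0\<close> \<delta> by (auto simp: h_def field_simps)
  have "\<forall>\<^sub>F u in at_top. k (u + h) - k u > a * h / 2"
    using lim[of h] h \<open>a > 0\<close> by (intro order_tendstoD) auto
  then obtain V where V: "\<And>u. u \<ge> V \<Longrightarrow> k (u + h) - k u > a * h / 2"
    by (auto simp: eventually_at_top_linorder)
  have steps: "k u + real n * (a * h / 2) \<le> k (u + real n * h)" if "u \<ge> V" for u n
  proof (induction n)
    case (Suc n)
    have "u + real n * h \<ge> V" using that h by (simp add: add_increasing2)
    have eqs: "real (Suc n) * (a * h / 2) = real n * (a * h / 2) + a * h / 2"
      "u + real (Suc n) * h = u + real n * h + h"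
      by (simp_all add: algebra_simps add_divide_distrib)
    show ?case
      unfolding eqs using V[OF \<open>u + real n * h \<ge> V\<close>] Suc by linarith
  qed simp
  show thesis
  proof
    show "a * \<sigma> / 4 > 0" using assms by simp
  next
    fix u v assume u: "max U V \<le> u" and v: "u + \<sigma> \<le> v"
    define n where "n = nat \<lfloor>(v - u) / h\<rfloor>"
    define s where "s = v - u - real n * h"
    have "v - u \<ge> 0" using v \<open>\<sigma> > 0\<close> by linarith
    hence "real n \<le> (v - u) / h" "(v - u) / h < real n + 1"
      using h by (auto simp: n_def)
    hence s: "0 \<le> s" "s < h"
      using h by (auto simp: s_def field_simps)
    have "real M * h < (real n + 1) * h"
      using s v h unfolding s_def by (simp add: algebra_simps)
    hence "real M < real n + 1" using h(1) by (metis mult_less_cancel_right_pos)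
    hence "M \<le> n" by linarith
    hence "\<sigma> \<le> real n * h" using h by (metis mult_right_mono of_nat_mono less_imp_le)
    hence "a * \<sigma> / 2 \<le> real n * (a * h / 2)"
      using \<open>a > 0\<close> by (simp add: algebra_simps)
    moreover have "k u + real n * (a * h / 2) \<le> k (u + real n * h)"
      using steps u by simp
    moreover have "\<bar>k (u + real n * h + s) - k (u + real n * h)\<bar> \<le> \<epsilon>"
      using s h u by (intro U) (auto simp: add_increasing2)
    moreover have eq: "u + real n * h + s = v" by (simp add: s_def)
    moreover have "0 < a * \<sigma>" using assms by simp
    ultimately show "k u + a * \<sigma> / 4 \<le> k v"
      unfolding \<epsilon>_def eq by linarith
  qed
qed

lemma regularly_varying_additive_limit:
  assumes RV: "regularly_varying_at_0 \<beta> f"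
  shows "((\<lambda>u. - ln (f (exp (- (u + s)))) - - ln (f (exp (- u)))) \<longlongrightarrow> \<beta> * s) at_top"
proof -
  have pos: "f x > 0" if "x > 0" for x
    using RV that by (auto simp: regularly_varying_at_0_def)
  have "((\<lambda>x. f (exp (- s) * x) / f x) \<longlongrightarrow> exp (- s) powr \<beta>) (at_right 0)"
    using RV by (auto simp: regularly_varying_at_0_def)
  moreover have "filterlim (\<lambda>u::real. exp (- u)) (at_right 0) at_top"
    by (auto simp: filterlim_at intro!: filterlim_compose[OF exp_at_bot] filterlim_uminus_at_bot_at_top)
  ultimately have "((\<lambda>u. f (exp (- s) * exp (- u)) / f (exp (- u))) \<longlongrightarrow> exp (- s) powr \<beta>) at_top"
    by (rule filterlim_compose)
  hence "((\<lambda>u. - ln (f (exp (- s) * exp (- u)) / f (exp (- u)))) \<longlongrightarrow> - ln (exp (- s) powr \<beta>)) at_top"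
    by (intro tendsto_minus tendsto_ln) auto
  moreover have "- ln (exp (- s) powr \<beta>) = \<beta> * s"
    by (simp add: powr_def)
  moreover have "- ln (f (exp (- s) * exp (- u)) / f (exp (- u))) =
      - ln (f (exp (- (u + s)))) - - ln (f (exp (- u)))" for u
    
  proof -
    have "exp (- s) * exp (- u) = exp (- (u + s))" by (simp flip: exp_add)
    thus ?thesis using pos[of "exp (- u)"] pos[of "exp (- (u + s))"] by (simp add: ln_divide_pos)
  qed
  ultimately show ?thesis by simp
qed

text \<open>
  Here \<open>v\<close> is a varying multiple of \<open>u\<close>, so the pointwise limit in the definition does not
  suffice; the local uniformity of that limit is what is used.
\<close>

lemma regularly_varying_asymp_equiv:
  fixes f :: "real \<Rightarrow> real" and u v :: "'b \<Rightarrow> real"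
  assumes cont: "continuous_on UNIV f"
    and RV: "regularly_varying_at_0 \<beta> f"
    and u_lim: "(u \<longlongrightarrow> 0) G"
    and u_pos: "\<forall>\<^sub>F t in G. u t > 0"
    and ratio: "((\<lambda>t. v t / u t) \<longlongrightarrow> 1) G"
  shows "((\<lambda>t. f (v t) / f (u t)) \<longlongrightarrow> 1) G"
proof -
  have pos: "f x > 0" if "x > 0" for x
    using RV that by (auto simp: regularly_varying_at_0_def)
  define k where "k w = - ln (f (exp (- w)))" for w
  have cont_k: "continuous_on UNIV k"
    unfolding k_def using pos
    by (intro continuous_intros continuous_on_compose2[OF cont]) (auto simp: less_imp_neq[symmetric])
  have v_lim: "(v \<longlongrightarrow> 0) G"
  proof -
    have "((\<lambda>t. v t / u t * u t) \<longlongrightarrow> 1 * 0) G"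
      by (intro tendsto_mult ratio u_lim)
    moreover have "\<forall>\<^sub>F t in G. v t / u t * u t = v t"
      using u_pos by eventually_elim simp
    ultimately show ?thesis by (simp add: tendsto_cong)
  qed
  have ln_lim: "((\<lambda>t. ln (v t / u t)) \<longlongrightarrow> 0) G"
    using tendsto_ln[OF ratio] by simp
  have ratio_pos: "\<forall>\<^sub>F t in G. v t / u t > 0"
    using ratio by (intro order_tendstoD) auto
  have "((\<lambda>t. k (- ln (v t)) - k (- ln (u t))) \<longlongrightarrow> 0) G"
  proof (rule tendstoI)
    fix e :: real assume "e > 0"
    hence "e / 2 > 0" by simp
    obtain \<delta> U where \<delta>: "\<delta> > 0"
      and U: "\<And>u s. U \<le> u \<Longrightarrow> 0 \<le> s \<Longrightarrow> s \<le> \<delta> \<Longrightarrow> \<bar>k (u + s) - k u\<bar> \<le> e / 2"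
      using additive_limit_locally_uniform[OF cont_k _ \<open>e / 2 > 0\<close>, of \<beta>]
        regularly_varying_additive_limit[OF RV] unfolding k_def by metis
    have "\<forall>\<^sub>F t in G. u t < exp (- U)" "\<forall>\<^sub>F t in G. v t < exp (- U)"
      using u_lim v_lim by (auto intro!: order_tendstoD)
    moreover have "\<forall>\<^sub>F t in G. \<bar>ln (v t / u t)\<bar> < \<delta>"
      using tendstoD[OF ln_lim \<delta>] by simp
    ultimately show "\<forall>\<^sub>F t in G. dist (k (- ln (v t)) - k (- ln (u t))) 0 < e"
      using u_pos ratio_pos
    proof eventually_elim
      case (elim t)
      hence "v t > 0" by (simp add: zero_less_divide_iff)
      have "ln (u t) < - U" "ln (v t) < - U"
        using elim \<open>v t > 0\<close> by (metis ln_exp ln_less_cancel_iff exp_gt_zero)+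
      moreover have "\<bar>ln (v t) - ln (u t)\<bar> < \<delta>"
        using elim \<open>v t > 0\<close> by (simp add: ln_div)
      ultimately have "\<bar>k (- ln (v t)) - k (- ln (u t))\<bar> \<le> e / 2"
        using U[of "- ln (v t)" "ln (v t) - ln (u t)"] U[of "- ln (u t)" "ln (u t) - ln (v t)"]
        by (cases "ln (u t) \<le> ln (v t)") (auto simp: abs_minus_commute)
      thus ?case using \<open>e > 0\<close> by simp
    qed
  qed
  hence "((\<lambda>t. exp (- (k (- ln (v t)) - k (- ln (u t))))) \<longlongrightarrow> exp (- 0)) G"
    by (intro tendsto_intros)
  moreover have "\<forall>\<^sub>F t in G. exp (- (k (- ln (v t)) - k (- ln (u t)))) = f (v t) / f (u t)"
    using u_pos ratio_pos
  proof eventually_elim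
    case (elim t)
    hence "v t > 0" by (simp add: zero_less_divide_iff)
    thus ?case using elim pos by (simp add: k_def exp_diff)
  qed
  ultimately show ?thesis by (simp add: tendsto_cong)
qed

text \<open>
  The function \<open>l w = - ln (f (exp (- w)) / exp (- w))\<close> has increments tending to
  \<open>(\<beta> - 1) s\<close>, so it gains a fixed amount \<open>c\<close> over every distance of at least \<open>ln (1 + \<eta>)\<close>.
  Half of this gain is given away in exchange for replacing \<open>f\<close> by an asymptotically
  equivalent \<open>k\<close> on one side; this allows for treating the negative half-line through
  \<open>k v = - f (- v)\<close>.
\<close>

lemma superlinear_regularly_varying_quotient:
  fixes f k :: "real \<Rightarrow> real"
  assumes cont: "continuous_on UNIV f"
    and RV: "regularly_varying_at_0 \<beta> f" and "\<beta> > 1"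
    and equiv: "((\<lambda>v. k v / f v) \<longlongrightarrow> 1) (at_right 0)"
    and "\<eta> > 0"
  obtains q \<delta> where "q > 1" "\<delta> > 0"
    "\<And>u v. 0 < u \<Longrightarrow> (1 + \<eta>) * u \<le> v \<Longrightarrow> v < \<delta> \<Longrightarrow> k v / v \<ge> q * (f u / u)"
    "\<And>u v. 0 < u \<Longrightarrow> (1 + \<eta>) * u \<le> v \<Longrightarrow> v < \<delta> \<Longrightarrow> f v / v \<ge> q * (k u / u)"
proof -
  have pos: "f x > 0" if "x > 0" for x
    using RV that by (auto simp: regularly_varying_at_0_def)
  define l where "l w = - ln (f (exp (- w))) - w" for w
  have cont_l: "continuous_on UNIV l"
    unfolding l_def using pos
    by (intro continuous_intros continuous_on_compose2[OF cont]) (auto simp: less_imp_neq[symmetric])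
  have lim_l: "((\<lambda>w. l (w + s) - l w) \<longlongrightarrow> (\<beta> - 1) * s) at_top" for s
  proof -
    have "((\<lambda>w. (- ln (f (exp (- (w + s)))) - - ln (f (exp (- w)))) - s) \<longlongrightarrow> \<beta> * s - s) at_top"
      by (intro tendsto_intros regularly_varying_additive_limit[OF RV])
    thus ?thesis by (simp add: l_def algebra_simps)
  qed
  have "\<beta> - 1 > 0" "ln (1 + \<eta>) > 0" using \<open>\<beta> > 1\<close> \<open>\<eta> > 0\<close> by auto
  then obtain c U where c: "c > 0"
    and U: "\<And>w z. U \<le> w \<Longrightarrow> w + ln (1 + \<eta>) \<le> z \<Longrightarrow> l w + c \<le> l z"
    using additive_limit_almost_increasing[OF cont_l lim_l] by metis
  have increasing: "f v / v \<ge> exp c * (f u / u)"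
    if uv: "0 < u" "(1 + \<eta>) * u \<le> v" "v < exp (- U)" for u v
  proof -
    have "v > 0" using uv \<open>\<eta> > 0\<close> by (smt (verit) mult_pos_pos)
    hence "ln v < - U" using uv by (metis ln_exp ln_less_cancel_iff exp_gt_zero)
    moreover have "ln (1 + \<eta>) + ln u \<le> ln v"
      using uv \<open>v > 0\<close> \<open>\<eta> > 0\<close> by (metis add_pos_pos ln_le_cancel_iff ln_mult_pos mult_pos_pos zero_less_one)
    ultimately have "l (- ln v) + c \<le> l (- ln u)"
      by (intro U) auto
    hence "exp (c + (ln (f u) - ln u)) \<le> exp (ln (f v) - ln v)"
      using uv \<open>v > 0\<close> by (simp add: l_def)
    thus ?thesis
      using uv \<open>v > 0\<close> pos by (simp add: exp_add exp_diff)
  qed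
  \<comment> \<open>The factor \<open>exp c\<close> is split as \<open>q * q\<close>: one \<open>q\<close> absorbs the discrepancy between \<open>k\<close> and \<open>f\<close>.\<close>
  define q where "q = exp (c / 2)"
  have q: "q > 1" "exp c = q * q" using c by (auto simp: q_def simp flip: exp_add)
  have "\<forall>\<^sub>F v in at_right 0. k v / f v > 1 / q \<and> k v / f v < q"
    using q equiv by (intro eventually_conj order_tendstoD) auto
  then obtain d where d: "d > 0" and kf: "\<And>v. 0 < v \<Longrightarrow> v < d \<Longrightarrow> k v / f v > 1 / q \<and> k v / f v < q"
    by (auto simp: eventually_at_right_field)
  have k_lower: "k v \<ge> f v / q" and k_upper: "k v \<le> q * f v" if "0 < v" "v < d" for v
    using kf[OF that] pos[OF that(1)] q by (auto simp: field_simps)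
  show thesis
  proof (rule that[of q "min d (exp (- U))"])
    show "q > 1" "min d (exp (- U)) > 0" using q d by auto
  next
    fix u v assume uv: "0 < u" "(1 + \<eta>) * u \<le> v" "v < min d (exp (- U))"
    have "u < v" 
    proof -
      have "u < (1 + \<eta>) * u" using uv \<open>\<eta> > 0\<close> by simp
      with uv show ?thesis by linarith
    qed
    have inc: "f v / v \<ge> q * q * (f u / u)" using increasing[of u v] uv q by simp
    have "f v / q / v \<ge> q * (f u / u)"
      using divide_right_mono[OF inc, of q] q by (simp add: divide_divide_eq_left mult.commute)
    also have "f v / q / v \<le> k v / v" 
      using uv \<open>u < v\<close> by (intro divide_right_mono k_lower) auto
    finally show "q * (f u / u) \<le> k v / v" .
    have "q * (k u / u) \<le> q * (q * f u / u)"
      using k_upper[of u] uv \<open>u < v\<close> q by (intro mult_left_mono divide_right_mono) auto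
    also have "\<dots> \<le> f v / v" using inc by (simp add: algebra_simps)
    finally show "q * (k u / u) \<le> f v / v" .
  qed
qed

section \<open>Scalar flows attracted to one\<close>

text \<open>
  At the last visit to the level \<open>m\<close> before a time at which \<open>z\<close> exceeds it, the negative derivative
  would carry \<open>z\<close> below \<open>m\<close>, forcing a later visit.
\<close>

lemma upper_barrier:
  fixes z z' :: "real \<Rightarrow> real"
  assumes deriv: "\<And>t. t \<ge> T \<Longrightarrow> (z has_real_derivative z' t) (at t)"
    and neg: "\<And>t. t \<ge> T \<Longrightarrow> z t = m \<Longrightarrow> z' t < 0"
    and init: "z T \<le> m" and "t \<ge> T"
  shows "z t \<le> m"
proof (rule ccontr)
  assume "\<not> z t \<le> m"
  define S where "S = {s\<in>{T..t}. z s = m}"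
  have cont: "continuous_on {T..t} z"
    by (intro continuous_at_imp_continuous_on ballI DERIV_isCont[OF deriv]) auto
  have "compact S"
  proof -
    have "closed S" unfolding S_def
      using continuous_closed_preimage_constant[OF cont, of m] by simp
    moreover have "bounded S" by (rule bounded_subset[of "{T..t}"]) (auto simp: S_def)
    ultimately show ?thesis by (simp add: compact_eq_bounded_closed)
  qed
  moreover have "S \<noteq> {}"
    using IVT'[OF init _ \<open>t \<ge> T\<close> cont] \<open>\<not> z t \<le> m\<close> by (force simp: S_def)
  ultimately obtain s where s: "s \<in> S" and last: "\<And>r. r \<in> S \<Longrightarrow> r \<le> s"
    by (meson compact_attains_sup)
  have "s \<noteq> t" using s \<open>\<not> z t \<le> m\<close> by (auto simp: S_def)
  hence "T \<le> s" "s < t" "z s = m" using s by (auto simp: S_def)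
  then obtain d where d: "d > 0" "\<And>h. 0 < h \<Longrightarrow> h < d \<Longrightarrow> z (s + h) < m"
    using DERIV_neg_dec_right[OF deriv neg] by metis
  define h where "h = min (d / 2) (t - s)"
  have h: "0 < h" "h < d" "s + h \<le> t" using d \<open>s < t\<close> by (auto simp: h_def)
  have "continuous_on {s + h..t} z"
    by (rule continuous_on_subset[OF cont]) (use h \<open>T \<le> s\<close> in auto)
  moreover have "z (s + h) \<le> m" using d h by (simp add: less_imp_le)
  ultimately obtain r where "r \<ge> s + h" "r \<le> t" "z r = m"
    using IVT'[of z "s + h" m t] h \<open>\<not> z t \<le> m\<close> by force
  hence "r \<le> s" using h \<open>T \<le> s\<close> by (intro last) (auto simp: S_def)
  thus False using h \<open>r \<ge> s + h\<close> by simp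
qed

text \<open>
  The clock \<open>L\<close> measures time; since it diverges, descending at a positive rate with respect to it
  must bring \<open>z\<close> down to \<open>m\<close>, and \<open>m\<close> is then a barrier.
\<close>

lemma eventually_le_of_descent:
  fixes z z' L w :: "real \<Rightarrow> real"
  assumes z: "\<And>t. t \<ge> T \<Longrightarrow> (z has_real_derivative z' t) (at t)"
    and L: "\<And>t. t \<ge> T \<Longrightarrow> (L has_real_derivative w t) (at t)"
    and w_pos: "\<And>t. t \<ge> T \<Longrightarrow> w t > 0"
    and L_lim: "filterlim L at_top at_top"
    and "c > 0"
    and descent: "\<And>t. t \<ge> T \<Longrightarrow> z t \<ge> m \<Longrightarrow> z' t \<le> - c * w t"
  shows "\<forall>\<^sub>F t in at_top. z t \<le> m"
proof -
  have "\<exists>t\<ge>T. z t \<le> m"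
  proof (rule ccontr)
    assume above: "\<not> (\<exists>t\<ge>T. z t \<le> m)"
    have bound: "z t + c * L t \<le> z T + c * L T" if "t \<ge> T" for t
    proof (rule DERIV_nonpos_imp_nonincreasing[OF that])
      fix s assume "T \<le> s" "s \<le> t"
      hence "((\<lambda>t. z t + c * L t) has_real_derivative z' s + c * w s) (at s)"
        by (intro DERIV_add DERIV_cmult z L)
      moreover have "z' s + c * w s \<le> 0"
        using descent[of s] above \<open>T \<le> s\<close> by force
      ultimately show "\<exists>y. ((\<lambda>t. z t + c * L t) has_real_derivative y) (at s) \<and> y \<le> 0" by blast
    qed
    have "\<forall>\<^sub>F t in at_top. L t > (z T + c * L T - m) / c"
      using L_lim by (simp add: filterlim_at_top_dense)
    hence "\<forall>\<^sub>F t::real in at_top. False"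
      using eventually_ge_at_top[of T]
    proof eventually_elim
      case (elim t)
      have "z t > m" using above elim by force
      moreover have "z T + c * L T - m < c * L t"
        using elim \<open>c > 0\<close> by (simp add: field_simps)
      ultimately show ?case using bound[OF elim(2)] by simp
    qed
    thus False by simp
  qed
  then obtain t0 where t0: "t0 \<ge> T" "z t0 \<le> m" by blast
  have "z t \<le> m" if "t \<ge> t0" for t
  proof (rule upper_barrier[of t0 z z'])
    fix s assume s: "s \<ge> t0" "z s = m"
    have "c * w s > 0" using w_pos[of s] s t0 \<open>c > 0\<close> by simp
    thus "z' s < 0" using descent[of s] s t0 by simp
  qed (use t0 that in \<open>auto intro!: z\<close>)
  thus ?thesis by (auto simp: eventually_at_top_linorder)
qed

text \<open>
  In this and the next two lemmas, \<open>r\<close> stands for the restoring term, which behaves like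
  \<open>z powr \<beta>\<close> for \<open>z > 0\<close>; only its comparison with \<open>z\<close> by a factor \<open>q > 1\<close> matters.
\<close>

lemma perturbed_flow_eventually_le:
  fixes z L w r e :: "real \<Rightarrow> real"
  assumes z: "\<forall>\<^sub>F t in at_top. (z has_real_derivative w t * (z t - r t + e t)) (at t)"
    and L: "\<forall>\<^sub>F t in at_top. (L has_real_derivative w t) (at t)"
    and w_pos: "\<forall>\<^sub>F t in at_top. w t > 0"
    and L_lim: "filterlim L at_top at_top"
    and e_lim: "(e \<longlongrightarrow> 0) at_top"
    and "m > 0" "q > 1"
    and r: "\<forall>\<^sub>F t in at_top. z t \<ge> m \<longrightarrow> r t \<ge> q * z t"
  shows "\<forall>\<^sub>F t in at_top. z t \<le> m"
proof -
  define c where "c = (q - 1) * m / 2"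
  have "c > 0" using assms by (simp add: c_def)
  hence "\<forall>\<^sub>F t in at_top. e t < c" using e_lim by (intro order_tendstoD)
  hence "\<forall>\<^sub>F t in at_top. (z has_real_derivative w t * (z t - r t + e t)) (at t) \<and>
      (L has_real_derivative w t) (at t) \<and> w t > 0 \<and> e t < c \<and>
      (z t \<ge> m \<longrightarrow> r t \<ge> q * z t)"
    using z L w_pos r by eventually_elim blast
  then obtain T where T: "\<And>t. t \<ge> T \<Longrightarrow> (z has_real_derivative w t * (z t - r t + e t)) (at t) \<and>
      (L has_real_derivative w t) (at t) \<and> w t > 0 \<and> e t < c \<and>
      (z t \<ge> m \<longrightarrow> r t \<ge> q * z t)"
    unfolding eventually_at_top_linorder by blast
  show ?thesis
  proof (rule eventually_le_of_descent[where z = z and w = w and L = L and T = T])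
    fix t assume t: "t \<ge> T" "z t \<ge> m"
    have "(q - 1) * m \<le> (q - 1) * z t" using t \<open>q > 1\<close> by (intro mult_left_mono) auto
    moreover have "2 * c = (q - 1) * m" by (simp add: c_def)
    ultimately have "2 * c \<le> q * z t - z t" by (simp add: algebra_simps)
    hence "z t - r t + e t \<le> - c" using T[of t] t by auto
    hence "w t * (z t - r t + e t) \<le> w t * (- c)"
      using T[of t] t by (intro mult_left_mono) auto
    thus "w t * (z t - r t + e t) \<le> - c * w t" by (simp add: mult.commute)
  qed (use T L_lim \<open>c > 0\<close> in auto)
qed

text \<open>
  Between \<open>l\<close> and \<open>m\<close> the drift is upwards with a margin that beats the perturbation. One late
  visit above \<open>l\<close> therefore makes \<open>l\<close> a lower barrier, and only after that is the bound on \<open>r\<close>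
  available at all times at which \<open>z\<close> is below \<open>m\<close>, so that \<open>z\<close> has to climb to \<open>m\<close>.
\<close>

lemma perturbed_flow_eventually_ge:
  fixes z L w r e :: "real \<Rightarrow> real"
  assumes z: "\<forall>\<^sub>F t in at_top. (z has_real_derivative w t * (z t - r t + e t)) (at t)"
    and L: "\<forall>\<^sub>F t in at_top. (L has_real_derivative w t) (at t)"
    and w_pos: "\<forall>\<^sub>F t in at_top. w t > 0"
    and L_lim: "filterlim L at_top at_top"
    and e_lim: "(e \<longlongrightarrow> 0) at_top"
    and "0 < l" "l \<le> m" "q > 1"
    and freq: "\<exists>\<^sub>F t in at_top. z t \<ge> l"
    and r: "\<forall>\<^sub>F t in at_top. l \<le> z t \<and> z t \<le> m \<longrightarrow> r t \<le> z t / q"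
  shows "\<forall>\<^sub>F t in at_top. z t \<ge> m"
proof -
  define c where "c = l * (1 - 1 / q) / 2"
  have "c > 0" using assms by (simp add: c_def)
  hence "\<forall>\<^sub>F t in at_top. e t > - c" using e_lim by (intro order_tendstoD) auto
  hence "\<forall>\<^sub>F t in at_top. (z has_real_derivative w t * (z t - r t + e t)) (at t) \<and>
      (L has_real_derivative w t) (at t) \<and> w t > 0 \<and> e t > - c \<and>
      (l \<le> z t \<and> z t \<le> m \<longrightarrow> r t \<le> z t / q)"
    using z L w_pos r by eventually_elim blast
  then obtain T where T: "\<And>t. t \<ge> T \<Longrightarrow> (z has_real_derivative w t * (z t - r t + e t)) (at t) \<and>
      (L has_real_derivative w t) (at t) \<and> w t > 0 \<and> e t > - c \<and>
      (l \<le> z t \<and> z t \<le> m \<longrightarrow> r t \<le> z t / q)"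
    unfolding eventually_at_top_linorder by blast
  have ascent: "c * w t \<le> w t * (z t - r t + e t)" if t: "t \<ge> T" "l \<le> z t" "z t \<le> m" for t
  proof -
    have "l * (1 - 1 / q) \<le> z t * (1 - 1 / q)" using t \<open>q > 1\<close> by (intro mult_right_mono) auto
    moreover have "2 * c = l * (1 - 1 / q)" by (simp add: c_def)
    ultimately have "2 * c \<le> z t - z t / q" by (simp add: algebra_simps)
    hence "c \<le> z t - r t + e t" using T[of t] t by auto
    hence "w t * c \<le> w t * (z t - r t + e t)"
      using T[of t] t by (intro mult_left_mono) auto
    thus ?thesis by (simp add: mult.commute)
  qed
  obtain t0 where t0: "t0 \<ge> T" "z t0 \<ge> l"
    using frequently_eventually_frequently[OF freq eventually_ge_at_top[of T]]
    by (auto dest: frequently_ex)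
  have ge_l: "z t \<ge> l" if "t \<ge> t0" for t
  proof -
    have "- z t \<le> - l"
    proof (rule upper_barrier[of t0 "\<lambda>t. - z t" "\<lambda>t. - (w t * (z t - r t + e t))"])
      fix s assume s: "s \<ge> t0" "- z s = - l"
      have "c * w s > 0" using T[of s] s t0 \<open>c > 0\<close> by simp
      thus "- (w s * (z s - r s + e s)) < 0" using ascent[of s] s t0 \<open>l \<le> m\<close> by simp
    qed (use t0 that T in \<open>auto intro!: DERIV_minus\<close>)
    thus ?thesis by simp
  qed
  have "\<forall>\<^sub>F t in at_top. - z t \<le> - m"
  proof (rule eventually_le_of_descent[where w = w and L = L and T = t0
        and z' = "\<lambda>t. - (w t * (z t - r t + e t))"])
    fix t assume "t \<ge> t0" "- z t \<ge> - m"
    thus "- (w t * (z t - r t + e t)) \<le> - c * w t"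
      using ascent[of t] ge_l[of t] t0 by simp
  qed (use T t0 L_lim \<open>c > 0\<close> in \<open>auto intro!: DERIV_minus\<close>)
  thus ?thesis by simp
qed

text \<open>
  The bounds on \<open>r\<close> are demanded for positive \<open>z\<close> only, so that a solution of either sign can be
  analysed by applying the lemma to it and to its negative.
\<close>

lemma perturbed_flow_dichotomy:
  fixes z L w r e :: "real \<Rightarrow> real"
  assumes z: "\<forall>\<^sub>F t in at_top. (z has_real_derivative w t * (z t - r t + e t)) (at t)"
    and L: "\<forall>\<^sub>F t in at_top. (L has_real_derivative w t) (at t)"
    and w_pos: "\<forall>\<^sub>F t in at_top. w t > 0"
    and L_lim: "filterlim L at_top at_top"
    and e_lim: "(e \<longlongrightarrow> 0) at_top"
    and r: "\<And>\<eta>. 0 < \<eta> \<Longrightarrow> \<exists>q>1. \<forall>\<^sub>F t in at_top.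
      (z t \<ge> 1 + \<eta> \<longrightarrow> r t \<ge> q * z t) \<and> (0 < z t \<and> z t \<le> 1 / (1 + \<eta>) \<longrightarrow> r t \<le> z t / q)"
  shows "(z \<longlongrightarrow> 1) at_top \<or> (\<forall>\<eta>>0. \<forall>\<^sub>F t in at_top. z t < \<eta>)"
proof (rule disjCI)
  assume "\<not> (\<forall>\<eta>>0. \<forall>\<^sub>F t in at_top. z t < \<eta>)"
  then obtain l where "l > 0" and freq: "\<exists>\<^sub>F t in at_top. z t \<ge> l"
    by (auto simp: not_eventually not_less)
  have upper: "\<forall>\<^sub>F t in at_top. z t \<le> 1 + \<eta>" if "\<eta> > 0" for \<eta>
  proof -
    obtain q where "q > 1" and "\<forall>\<^sub>F t in at_top.
      (z t \<ge> 1 + \<eta> \<longrightarrow> r t \<ge> q * z t) \<and> (0 < z t \<and> z t \<le> 1 / (1 + \<eta>) \<longrightarrow> r t \<le> z t / q)"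
      using r[OF \<open>\<eta> > 0\<close>] by blast
    hence q: "\<forall>\<^sub>F t in at_top. z t \<ge> 1 + \<eta> \<longrightarrow> r t \<ge> q * z t"
      by (auto elim: eventually_mono)
    show ?thesis
      using that by (intro perturbed_flow_eventually_le[OF z L w_pos L_lim e_lim _ \<open>q > 1\<close> q]) auto
  qed
  have lower: "\<forall>\<^sub>F t in at_top. z t \<ge> 1 / (1 + \<eta>)" if "\<eta> > 0" for \<eta>
  proof -
    \<comment> \<open>The entry level must not lie above the level that is to be reached.\<close>
    define l' where "l' = min l (1 / (1 + \<eta>))"
    have l': "l' > 0" "l' \<le> 1 / (1 + \<eta>)" using \<open>l > 0\<close> that by (auto simp: l'_def)
    obtain q where "q > 1" and "\<forall>\<^sub>F t in at_top.
      (z t \<ge> 1 + \<eta> \<longrightarrow> r t \<ge> q * z t) \<and> (0 < z t \<and> z t \<le> 1 / (1 + \<eta>) \<longrightarrow> r t \<le> z t / q)"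
      using r[OF \<open>\<eta> > 0\<close>] by blast
    hence q: "\<forall>\<^sub>F t in at_top. l' \<le> z t \<and> z t \<le> 1 / (1 + \<eta>) \<longrightarrow> r t \<le> z t / q"
      using l' by (auto elim!: eventually_mono)
    have "\<exists>\<^sub>F t in at_top. z t \<ge> l'"
      using freq by (rule frequently_elim1) (simp add: l'_def)
    thus ?thesis
      using l' by (intro perturbed_flow_eventually_ge[OF z L w_pos L_lim e_lim l' \<open>q > 1\<close> _ q])
  qed
  show "(z \<longlongrightarrow> 1) at_top"
  proof (rule order_tendstoI)
    fix a :: real assume "a < 1"
    define \<eta> where "\<eta> = (if a \<le> 0 then 1 else (1 / a - 1) / 2)"
    have "\<eta> > 0" using \<open>a < 1\<close> by (simp add: \<eta>_def)
    moreover have "a < 1 / (1 + \<eta>)"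
      using \<open>a < 1\<close> by (simp add: \<eta>_def field_simps)
    ultimately show "\<forall>\<^sub>F t in at_top. z t > a"
      using lower[of \<eta>] by (auto elim: eventually_mono)
  next
    fix a :: real assume "1 < a"
    hence "\<forall>\<^sub>F t in at_top. z t \<le> 1 + (a - 1) / 2" by (intro upper) simp
    thus "\<forall>\<^sub>F t in at_top. z t < a"
      by (rule eventually_mono) (use \<open>1 < a\<close> in \<open>simp add: field_simps\<close>)
  qed
qed

section \<open>The inverse of the reciprocal integral\<close>

lemma recip_integral_deriv:
  assumes cont: "continuous_on {0<..} f" and pos: "\<And>u. u > 0 \<Longrightarrow> f u > 0" and "x > 0"
  shows "(recip_integral f has_real_derivative - (1 / f x)) (at x)"
proof -
  define a b where "a = min x 1 / 2" and "b = max x 1 + 1"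
  have ab: "0 < a" "a < x" "x < b" "a \<le> 1" "1 \<le> b" using \<open>x > 0\<close> by (auto simp: a_def b_def)
  have "f u \<noteq> 0" if "u \<in> {a..b}" for u using pos[of u] ab that by auto
  moreover have "continuous_on {a..b} f" by (rule continuous_on_subset[OF cont]) (use ab in auto)
  ultimately have "continuous_on {a..b} (\<lambda>u. 1 / f u)"
    by (intro continuous_on_divide continuous_on_const) auto
  hence "((\<lambda>t. LBINT u=ereal 1..ereal t. 1 / f u) has_vector_derivative 1 / f x) (at x within {a..b})"
    by (rule interval_integral_FTC2[OF \<open>a \<le> 1\<close> \<open>1 \<le> b\<close>]) (use ab in auto)
  hence "((\<lambda>t. LBINT u=ereal 1..ereal t. 1 / f u) has_vector_derivative 1 / f x) (at x)"
    using ab by (simp add: at_within_Icc_at)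
  hence "((\<lambda>t. - (LBINT u=ereal 1..ereal t. 1 / f u)) has_real_derivative - (1 / f x)) (at x)"
    by (intro DERIV_minus) (simp add: has_real_derivative_iff_has_vector_derivative)
  moreover have "recip_integral f = (\<lambda>t. - (LBINT u=ereal 1..ereal t. 1 / f u))"
    unfolding recip_integral_def by (rule ext, rule interval_integral_endpoints_reverse)
  ultimately show ?thesis by simp
qed

lemma recip_integral_strict_antimono:
  assumes cont: "continuous_on {0<..} f" and pos: "\<And>u. u > 0 \<Longrightarrow> f u > 0" and "0 < x" "x < y"
  shows "recip_integral f y < recip_integral f x"
proof (rule DERIV_neg_imp_decreasing[OF \<open>x < y\<close>])
  fix u assume "x \<le> u" "u \<le> y"
  hence "u > 0" using \<open>0 < x\<close> by simp
  thus "\<exists>d. (recip_integral f has_real_derivative d) (at u) \<and> d < 0"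
    using recip_integral_deriv[OF cont pos] pos by (intro exI[of _ "- (1 / f u)"]) auto
qed

text \<open>
  Near \<open>0\<close> the integrand \<open>1 / f u\<close> exceeds \<open>1 / u\<close>, so \<open>F\<close> grows at least as fast as \<open>- ln\<close>.
\<close>

lemma recip_integral_unbounded:
  assumes cont: "continuous_on {0<..} f" and pos: "\<And>u. u > 0 \<Longrightarrow> f u > 0"
    and sublin: "((\<lambda>u. f u / u) \<longlongrightarrow> 0) (at_right 0)"
  shows "\<exists>x>0. recip_integral f x \<ge> t"
proof -
  have "\<forall>\<^sub>F u in at_right 0. f u / u < 1"
    using sublin by (intro order_tendstoD) auto
  then obtain d where d: "d > 0" "\<And>u. 0 < u \<Longrightarrow> u < d \<Longrightarrow> f u / u < 1"
    by (auto simp: eventually_at_right_field)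
  define b where "b = d / 2"
  have b: "0 < b" "b < d" using d by (auto simp: b_def)
  have lower: "recip_integral f b + ln b \<le> recip_integral f x + ln x" if x: "0 < x" "x \<le> b" for x
  proof (rule DERIV_nonpos_imp_nonincreasing[OF \<open>x \<le> b\<close>])
    fix u assume "x \<le> u" "u \<le> b"
    hence u: "0 < u" "f u < u" using d(2)[of u] b x by auto
    have "((\<lambda>u. recip_integral f u + ln u) has_real_derivative - (1 / f u) + inverse u) (at u)"
      using u by (intro DERIV_add recip_integral_deriv cont pos DERIV_ln)
    moreover have "- (1 / f u) + inverse u \<le> 0"
      using u pos[of u] by (simp add: field_simps)
    ultimately show "\<exists>y. ((\<lambda>u. recip_integral f u + ln u) has_real_derivative y) (at u) \<and> y \<le> 0"
      by blast
  qed
  define x where "x = min b (exp (recip_integral f b + ln b - t))"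
  have x: "0 < x" "x \<le> b" using b by (auto simp: x_def)
  have "ln x \<le> ln (exp (recip_integral f b + ln b - t))" using x by (subst ln_le_cancel_iff) (auto simp: x_def)
  with lower[OF x] have "recip_integral f x \<ge> t" by simp
  with x show ?thesis by blast
qed

text \<open>
  For \<open>t \<ge> 0\<close> the value \<open>t\<close> lies between \<open>F 1 = 0\<close> and a large value attained close to \<open>0\<close>, hence in
  the range of \<open>F\<close>. For negative \<open>t\<close> this may fail, since \<open>F\<close> can be bounded below.
\<close>

lemma recip_integral_inv_properties:
  assumes cont: "continuous_on {0<..} f" and pos: "\<And>u. u > 0 \<Longrightarrow> f u > 0"
    and sublin: "((\<lambda>u. f u / u) \<longlongrightarrow> 0) (at_right 0)" and "t \<ge> 0"
  shows recip_integral_inv_pos: "recip_integral_inv f t > 0"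
    and recip_integral_inv_right: "recip_integral f (recip_integral_inv f t) = t"
proof -
  obtain x0 where x0: "x0 > 0" "recip_integral f x0 \<ge> t"
    using recip_integral_unbounded[OF cont pos sublin] by blast
  have "recip_integral f 1 = 0"
    by (simp add: recip_integral_def interval_lebesgue_integral_def einterval_same
        set_lebesgue_integral_def)
  hence "x0 \<le> 1"
    using recip_integral_strict_antimono[OF cont pos, of 1 x0] x0 \<open>t \<ge> 0\<close> by force
  have "\<forall>x. x0 \<le> x \<and> x \<le> 1 \<longrightarrow> isCont (recip_integral f) x"
    using x0 by (auto intro!: DERIV_isCont recip_integral_deriv cont pos)
  then obtain x where "x0 \<le> x" "recip_integral f x = t"
    using IVT2[of "recip_integral f" 1 t x0] x0 \<open>x0 \<le> 1\<close> \<open>t \<ge> 0\<close> \<open>recip_integral f 1 = 0\<close> by auto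
  hence t: "t \<in> recip_integral f ` {0<..}" using x0 by force
  show "recip_integral_inv f t > 0" "recip_integral f (recip_integral_inv f t) = t"
    using inv_into_into[OF t] f_inv_into_f[OF t] by (auto simp: recip_integral_inv_def)
qed

lemma recip_integral_inv_deriv:
  assumes cont: "continuous_on {0<..} f" and pos: "\<And>u. u > 0 \<Longrightarrow> f u > 0"
    and sublin: "((\<lambda>u. f u / u) \<longlongrightarrow> 0) (at_right 0)" and "t > 0"
  shows "(recip_integral_inv f has_real_derivative - f (recip_integral_inv f t)) (at t)"
proof -
  define y where "y = recip_integral_inv f t"
  have y: "y > 0" "recip_integral f y = t"
    using recip_integral_inv_properties[OF cont pos sublin, of t] \<open>t > 0\<close> by (auto simp: y_def)
  have inj: "inj_on (recip_integral f) {0<..}"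
    using recip_integral_strict_antimono[OF cont pos] by (force intro: linorder_inj_onI)
  have "isCont (recip_integral_inv f) (recip_integral f y)"
  proof (rule isCont_inverse_function2[of "y / 2" y "2 * y"])
    fix u assume "y / 2 \<le> u" "u \<le> 2 * y"
    hence "u > 0" using y by simp
    thus "recip_integral_inv f (recip_integral f u) = u"
      unfolding recip_integral_inv_def by (intro inv_into_f_f inj) auto
    show "isCont (recip_integral f) u"
      by (rule DERIV_isCont[OF recip_integral_deriv[OF cont pos \<open>u > 0\<close>]])
  qed (use y in auto)
  hence "isCont (recip_integral_inv f) t" by (simp add: y)
  hence "(recip_integral_inv f has_real_derivative inverse (- (1 / f y))) (at t)"
    using recip_integral_deriv[OF cont pos \<open>y > 0\<close>] pos[of y] y \<open>t > 0\<close>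
      recip_integral_inv_right[OF cont pos sublin]
    by (intro DERIV_inverse_function[where f = "recip_integral f" and a = 0 and b = "t + 1"])
      (auto simp: y_def)
  thus ?thesis by (simp add: y_def)
qed

lemma recip_integral_inv_tendsto_0:
  assumes cont: "continuous_on {0<..} f" and pos: "\<And>u. u > 0 \<Longrightarrow> f u > 0"
    and sublin: "((\<lambda>u. f u / u) \<longlongrightarrow> 0) (at_right 0)"
  shows "(recip_integral_inv f \<longlongrightarrow> 0) at_top"
proof (rule order_tendstoI)
  fix a :: real assume "a < 0"
  show "\<forall>\<^sub>F t in at_top. a < recip_integral_inv f t"
    using eventually_ge_at_top[of 0]
    by eventually_elim
      (use recip_integral_inv_pos[OF cont pos sublin] \<open>a < 0\<close> in force)
next
  fix a :: real assume "0 < a"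
  show "\<forall>\<^sub>F t in at_top. recip_integral_inv f t < a"
    using eventually_gt_at_top[of "max 0 (recip_integral f a)"]
  proof eventually_elim
    case (elim t)
    show ?case
    proof (rule ccontr)
      assume "\<not> recip_integral_inv f t < a"
      hence "recip_integral f (recip_integral_inv f t) \<le> recip_integral f a"
        using recip_integral_strict_antimono[OF cont pos \<open>0 < a\<close>, of "recip_integral_inv f t"]
        by force
      thus False using elim recip_integral_inv_right[OF cont pos sublin, of t] by simp
    qed
  qed
qed

section \<open>Ratios of solutions of the perturbed and the unperturbed equation\<close>

text \<open>
  The odd function is only a witness; what is needed of it is that the reflection \<open>- f (- y)\<close> is
  asymptotically equivalent to \<open>f\<close>.
\<close>

lemma asymptotically_odd_reflection:
  fixes f \<phi> :: "real \<Rightarrow> real"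
  assumes odd: "\<And>y. \<phi> (- y) = - \<phi> y" and equiv: "((\<lambda>y. f y / \<phi> y) \<longlongrightarrow> 1) (at 0)"
  shows "((\<lambda>y. - f (- y) / f y) \<longlongrightarrow> 1) (at 0)"
proof -
  have "filterlim uminus (at 0) (at (0 :: real))"
    by (auto simp: filterlim_at eventually_at_filter intro!: tendsto_eq_intros)
  from filterlim_compose[OF equiv this]
  have "((\<lambda>y. (f (- y) / \<phi> (- y)) / (f y / \<phi> y)) \<longlongrightarrow> 1 / 1) (at 0)"
    by (intro tendsto_divide equiv) (auto simp: o_def)
  moreover have "\<forall>\<^sub>F y in at 0. f y / \<phi> y > 0"
    using equiv by (intro order_tendstoD) auto
  hence "\<forall>\<^sub>F y in at 0. (f (- y) / \<phi> (- y)) / (f y / \<phi> y) = - f (- y) / f y"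
    by eventually_elim (auto simp: odd)
  ultimately show ?thesis by (simp add: tendsto_cong)
qed

text \<open>
  This makes \<open>k v / f u\<close> a restoring term in the sense of \<open>perturbed_flow_dichotomy\<close>: multiplying the
  bounds for \<open>k v / v\<close> and \<open>f u / u\<close> by \<open>v / u\<close> compares \<open>k v / f u\<close> with \<open>v / u\<close>.
\<close>

lemma superlinear_ratio_bounds:
  fixes f k :: "real \<Rightarrow> real" and u v :: "'b \<Rightarrow> real"
  assumes cont: "continuous_on UNIV f"
    and RV: "regularly_varying_at_0 \<beta> f" and "\<beta> > 1"
    and equiv: "((\<lambda>v. k v / f v) \<longlongrightarrow> 1) (at_right 0)"
    and u_lim: "(u \<longlongrightarrow> 0) G" and u_pos: "\<forall>\<^sub>F t in G. u t > 0"
    and v_lim: "(v \<longlongrightarrow> 0) G"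
    and "\<eta> > 0"
  shows "\<exists>q>1. \<forall>\<^sub>F t in G.
    (v t / u t \<ge> 1 + \<eta> \<longrightarrow> k (v t) / f (u t) \<ge> q * (v t / u t)) \<and>
    (0 < v t / u t \<and> v t / u t \<le> 1 / (1 + \<eta>) \<longrightarrow> k (v t) / f (u t) \<le> (v t / u t) / q)"
proof -
  have pos: "f x > 0" if "x > 0" for x
    using RV that by (auto simp: regularly_varying_at_0_def)
  obtain q \<delta> where q: "q > 1" and \<delta>: "\<delta> > 0"
    and k_large: "\<And>u v. 0 < u \<Longrightarrow> (1 + \<eta>) * u \<le> v \<Longrightarrow> v < \<delta> \<Longrightarrow> k v / v \<ge> q * (f u / u)"
    and k_small: "\<And>u v. 0 < u \<Longrightarrow> (1 + \<eta>) * u \<le> v \<Longrightarrow> v < \<delta> \<Longrightarrow> f v / v \<ge> q * (k u / u)"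
    using superlinear_regularly_varying_quotient[OF cont RV \<open>\<beta> > 1\<close> equiv \<open>\<eta> > 0\<close>] by metis
  have "\<forall>\<^sub>F t in G. u t < \<delta>" "\<forall>\<^sub>F t in G. v t < \<delta>"
    using u_lim v_lim \<delta> by (auto intro: order_tendstoD)
  with u_pos have "\<forall>\<^sub>F t in G.
    (v t / u t \<ge> 1 + \<eta> \<longrightarrow> k (v t) / f (u t) \<ge> q * (v t / u t)) \<and>
    (0 < v t / u t \<and> v t / u t \<le> 1 / (1 + \<eta>) \<longrightarrow> k (v t) / f (u t) \<le> (v t / u t) / q)"
  proof eventually_elim
    case (elim t)
    note f_pos = pos[OF \<open>u t > 0\<close>]
    show ?case
    proof (intro conjI impI; (elim conjE)?)
      assume large: "v t / u t \<ge> 1 + \<eta>"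
      hence le: "(1 + \<eta>) * u t \<le> v t" using elim by (simp add: pos_le_divide_eq)
      hence "v t > 0" using elim \<open>\<eta> > 0\<close> by (smt (verit) mult_pos_pos)
      with k_large[OF _ le] elim f_pos show "q * (v t / u t) \<le> k (v t) / f (u t)"
        by (simp add: field_simps)
    next
      assume "0 < v t / u t" and small: "v t / u t \<le> 1 / (1 + \<eta>)"
      hence "v t > 0" using elim by (simp add: zero_less_divide_iff)
      have le: "(1 + \<eta>) * v t \<le> u t" using small elim \<open>\<eta> > 0\<close> by (simp add: field_simps)
      with k_small[OF \<open>v t > 0\<close> le] elim f_pos \<open>v t > 0\<close> q
      show "k (v t) / f (u t) \<le> (v t / u t) / q"
        by (simp add: field_simps)
    qed
  qed
  with q show ?thesis by blast
qed

text \<open>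
  For \<open>c = 1\<close> this is local uniformity and for \<open>c = -1\<close> its reflection. For \<open>c = 0\<close> the sign of \<open>v\<close>
  may vary, but \<open>f (v) / v\<close> does not exceed \<open>f (u) / u\<close> once \<open>\<bar>v\<bar> \<le> u / 2\<close>, which bounds
  \<open>\<bar>f (v) / f (u)\<bar>\<close> by \<open>\<bar>v / u\<bar>\<close>.
\<close>

lemma regularly_varying_ratio_limit:
  fixes f :: "real \<Rightarrow> real" and u v :: "'b \<Rightarrow> real"
  assumes cont: "continuous_on UNIV f" and zero: "f 0 = 0"
    and nonpos: "\<And>y. y < 0 \<Longrightarrow> f y \<le> 0"
    and RV: "regularly_varying_at_0 \<beta> f" and "\<beta> > 1"
    and refl: "((\<lambda>y. - f (- y) / f y) \<longlongrightarrow> 1) (at_right 0)"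
    and u_lim: "(u \<longlongrightarrow> 0) G" and u_pos: "\<forall>\<^sub>F t in G. u t > 0"
    and ratio: "((\<lambda>t. v t / u t) \<longlongrightarrow> c) G" and c: "c \<in> {-1, 0, 1}"
  shows "((\<lambda>t. f (v t) / f (u t)) \<longlongrightarrow> c) G"
proof -
  have pos: "f x > 0" if "x > 0" for x
    using RV that by (auto simp: regularly_varying_at_0_def)
  have v_lim: "(v \<longlongrightarrow> 0) G"
  proof -
    have "((\<lambda>t. v t / u t * u t) \<longlongrightarrow> c * 0) G"
      by (intro tendsto_mult ratio u_lim)
    moreover have "\<forall>\<^sub>F t in G. v t / u t * u t = v t"
      using u_pos by eventually_elim simp
    ultimately show ?thesis by (simp add: tendsto_cong)
  qed
  from c consider "c = 1" | "c = -1" | "c = 0" by auto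
  thus ?thesis
  proof cases
    case 1
    thus ?thesis using regularly_varying_asymp_equiv[OF cont RV u_lim u_pos] ratio by simp
  next
    case 2
    have ratio': "((\<lambda>t. - v t / u t) \<longlongrightarrow> 1) G"
      using tendsto_minus[OF ratio] 2 by simp
    hence "\<forall>\<^sub>F t in G. - v t / u t > 0" by (intro order_tendstoD) auto
    hence v_neg: "\<forall>\<^sub>F t in G. - v t > 0"
      using u_pos by eventually_elim (auto simp: zero_less_divide_iff divide_less_0_iff)
    have "filterlim (\<lambda>t. - v t) (at_right 0) G"
      using v_neg tendsto_minus[OF v_lim] by (auto simp: filterlim_at elim: eventually_mono)
    from filterlim_compose[OF refl this]
    have "((\<lambda>t. - f (v t) / f (- v t)) \<longlongrightarrow> 1) G" by simp
    moreover have "((\<lambda>t. f (- v t) / f (u t)) \<longlongrightarrow> 1) G"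
      by (rule regularly_varying_asymp_equiv[OF cont RV u_lim u_pos ratio'])
    ultimately have "((\<lambda>t. - (- f (v t) / f (- v t) * (f (- v t) / f (u t)))) \<longlongrightarrow> - (1 * 1)) G"
      by (intro tendsto_intros)
    moreover have "\<forall>\<^sub>F t in G. - (- f (v t) / f (- v t) * (f (- v t) / f (u t))) = f (v t) / f (u t)"
      using v_neg
    proof eventually_elim
      case (elim t)
      from pos[OF elim] show ?case by simp
    qed
    ultimately have "((\<lambda>t. f (v t) / f (u t)) \<longlongrightarrow> - (1 * 1)) G"
      by (rule Lim_transform_eventually)
    thus ?thesis using 2 by simp
  next
    case 3
    have "\<forall>\<^sub>F y in at_right 0. f y / f y = 1"
      using eventually_at_right_less[of "0::real"] by eventually_elim (metis pos divide_self less_irrefl)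
    hence self: "((\<lambda>y. f y / f y) \<longlongrightarrow> 1) (at_right 0)" by (rule tendsto_eventually)
    have small: "\<forall>\<^sub>F t in G. 0 < a t / u t \<and> a t / u t \<le> 1 / 2 \<longrightarrow> k (a t) / f (u t) \<le> a t / u t"
      if a_lim: "(a \<longlongrightarrow> 0) G" and k_equiv: "((\<lambda>y. k y / f y) \<longlongrightarrow> 1) (at_right 0)"
      for a k
    proof -
      obtain q where "q > 1" and q: "\<forall>\<^sub>F t in G.
          (a t / u t \<ge> 1 + 1 \<longrightarrow> k (a t) / f (u t) \<ge> q * (a t / u t)) \<and>
          (0 < a t / u t \<and> a t / u t \<le> 1 / (1 + 1) \<longrightarrow> k (a t) / f (u t) \<le> (a t / u t) / q)"
        using superlinear_ratio_bounds[OF cont RV \<open>\<beta> > 1\<close> k_equiv u_lim u_pos a_lim zero_less_one]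
        by blast
      have shrink: "b / q \<le> b" if "b > 0" for b
        using that \<open>q > 1\<close> by (simp add: field_simps)
      from q show ?thesis
        by eventually_elim (use shrink order_trans in \<open>auto simp only: one_add_one\<close>)
    qed
    have neg_lim: "((\<lambda>t. - v t) \<longlongrightarrow> 0) G" using tendsto_minus[OF v_lim] by simp
    have "\<forall>\<^sub>F t in G. \<bar>v t / u t\<bar> < 1 / 2"
      using tendstoD[OF ratio, of "1 / 2"] 3 by simp
    hence "\<forall>\<^sub>F t in G. norm (f (v t) / f (u t)) \<le> \<bar>v t / u t\<bar>"
      using small[OF v_lim self] small[OF neg_lim refl] u_pos
    proof eventually_elim
      case (elim t)
      have "f (u t) > 0" using pos elim by simp
      consider "v t > 0" | "v t = 0" | "v t < 0" by linarith
      thus ?case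
      proof cases
        case 1
        hence "v t / u t > 0" using elim by simp
        hence "f (v t) / f (u t) \<le> v t / u t" using elim by linarith
        thus ?thesis using 1 elim pos[of "v t"] \<open>f (u t) > 0\<close> by simp
      next
        case 3
        hence "- v t / u t > 0" using elim by (simp add: divide_less_0_iff)
        moreover have "- v t / u t = - (v t / u t)" by simp
        hence "- v t / u t \<le> 1 / 2" using elim(1) by linarith
        ultimately have "- f (v t) / f (u t) \<le> - v t / u t"
          using elim(3)[unfolded minus_minus] by blast
        moreover have "\<bar>f (v t)\<bar> = - f (v t)" "\<bar>v t\<bar> = - v t" using nonpos[OF 3] 3 by auto
        ultimately show ?thesis using elim \<open>f (u t) > 0\<close> by simp
      qed (simp add: zero)
    qed
    moreover have "((\<lambda>t. \<bar>v t / u t\<bar>) \<longlongrightarrow> 0) G"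
      using tendsto_rabs[OF ratio] 3 by simp
    ultimately show ?thesis using 3 by (auto intro: Lim_null_comparison)
  qed
qed

text \<open>
  The time change is \<open>L = - ln y\<close>. The reflected solution \<open>- x\<close> satisfies the same kind of equation
  with \<open>f\<close> replaced by \<open>- f (- v)\<close>, while \<open>y\<close> stays the solution for the original \<open>f\<close>; this is why the
  ratio bounds compare two different functions.
\<close>

lemma perturbed_ratio_limit:
  fixes f g x y :: "real \<Rightarrow> real"
  assumes cont: "continuous_on UNIV f"
    and RV: "regularly_varying_at_0 \<beta> f" and "\<beta> > 1"
    and refl: "((\<lambda>y. - f (- y) / f y) \<longlongrightarrow> 1) (at_right 0)"
    and y_lim: "(y \<longlongrightarrow> 0) at_top" and y_pos: "\<And>t. t > 0 \<Longrightarrow> y t > 0"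
    and y_ode: "\<And>t. t > 0 \<Longrightarrow> (y has_real_derivative - f (y t)) (at t)"
    and x_lim: "(x \<longlongrightarrow> 0) at_top"
    and x_ode: "\<And>t. t > 0 \<Longrightarrow> (x has_real_derivative - f (x t) + g t) (at t)"
    and g_lim: "((\<lambda>t. g t / f (y t)) \<longlongrightarrow> 0) at_top"
  shows "\<exists>c\<in>{-1, 0, 1}. ((\<lambda>t. x t / y t) \<longlongrightarrow> c) at_top"
proof -
  have pos: "f x > 0" if "x > 0" for x
    using RV that by (auto simp: regularly_varying_at_0_def)
  define w where "w t = f (y t) / y t" for t
  have y_ev: "\<forall>\<^sub>F t in at_top. y t > 0"
    using eventually_gt_at_top[of 0] by eventually_elim (rule y_pos)
  have w_pos: "\<forall>\<^sub>F t in at_top. w t > 0"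
    using y_ev by eventually_elim (simp add: w_def pos)
  have L: "\<forall>\<^sub>F t in at_top. ((\<lambda>t. - ln (y t)) has_real_derivative w t) (at t)"
    using eventually_gt_at_top[of 0]
  proof eventually_elim
    case (elim t)
    show ?case
      using y_pos[OF elim] unfolding w_def
      by (auto intro!: derivative_eq_intros y_ode[OF elim])
  qed
  have L_lim: "filterlim (\<lambda>t. - ln (y t)) at_top at_top"
  proof -
    have "filterlim y (at_right 0) at_top"
      using y_lim y_ev by (auto simp: filterlim_at elim: eventually_mono)
    thus ?thesis
      by (intro filterlim_compose[OF filterlim_uminus_at_top_at_bot] filterlim_compose[OF ln_at_0])
  qed
  have flow: "((\<lambda>t. x t / y t) has_real_derivative
      w t * (x t / y t - f (x t) / f (y t) + g t / f (y t))) (at t)" if "t > 0" for t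
  proof -
    have "y t > 0" "f (y t) > 0" using that y_pos pos by auto
    hence "((- f (x t) + g t) * y t - x t * - f (y t)) / (y t * y t) =
        w t * (x t / y t - f (x t) / f (y t) + g t / f (y t))"
      by (simp add: w_def field_simps)
    thus ?thesis
      using DERIV_divide[OF x_ode[OF that] y_ode[OF that]] \<open>y t > 0\<close> by simp
  qed
  have flow_ev: "\<forall>\<^sub>F t in at_top. ((\<lambda>t. x t / y t) has_real_derivative
      w t * (x t / y t - f (x t) / f (y t) + g t / f (y t))) (at t)"
    using eventually_gt_at_top[of 0] by eventually_elim (rule flow)
  have neg_flow_ev: "\<forall>\<^sub>F t in at_top. ((\<lambda>t. - x t / y t) has_real_derivative
      w t * (- x t / y t - (- f (- (- x t)) / f (y t)) + - (g t / f (y t)))) (at t)"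
    using eventually_gt_at_top[of 0]
  proof eventually_elim
    case (elim t)
    from DERIV_minus[OF flow[OF elim]] show ?case
      by (simp add: algebra_simps)
  qed
  have "\<forall>\<^sub>F y in at_right 0. f y / f y = 1"
    using eventually_at_right_less[of "0::real"] by eventually_elim (metis pos divide_self less_irrefl)
  hence self: "((\<lambda>y. f y / f y) \<longlongrightarrow> 1) (at_right 0)" by (rule tendsto_eventually)
  have upper: "((\<lambda>t. x t / y t) \<longlongrightarrow> 1) at_top \<or> (\<forall>\<eta>>0. \<forall>\<^sub>F t in at_top. x t / y t < \<eta>)"
    by (rule perturbed_flow_dichotomy[OF flow_ev L w_pos L_lim g_lim
          superlinear_ratio_bounds[OF cont RV \<open>\<beta> > 1\<close> self y_lim y_ev x_lim]])
  have neg_lim: "((\<lambda>t. - x t) \<longlongrightarrow> 0) at_top" "((\<lambda>t. - (g t / f (y t))) \<longlongrightarrow> 0) at_top"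
    using tendsto_minus[OF x_lim] tendsto_minus[OF g_lim] by auto
  have lower: "((\<lambda>t. - x t / y t) \<longlongrightarrow> 1) at_top \<or> (\<forall>\<eta>>0. \<forall>\<^sub>F t in at_top. - x t / y t < \<eta>)"
    by (rule perturbed_flow_dichotomy[OF neg_flow_ev L w_pos L_lim neg_lim(2)
          superlinear_ratio_bounds[OF cont RV \<open>\<beta> > 1\<close> refl y_lim y_ev neg_lim(1)]])
  consider "((\<lambda>t. x t / y t) \<longlongrightarrow> 1) at_top" | "((\<lambda>t. - x t / y t) \<longlongrightarrow> 1) at_top"
    | "\<forall>\<eta>>0. \<forall>\<^sub>F t in at_top. x t / y t < \<eta>" "\<forall>\<eta>>0. \<forall>\<^sub>F t in at_top. - x t / y t < \<eta>"
    using upper lower by blast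
  thus ?thesis
  proof cases
    case 2
    from tendsto_minus[OF this] show ?thesis by simp
  next
    case 3
    have "((\<lambda>t. x t / y t) \<longlongrightarrow> 0) at_top"
    proof (rule order_tendstoI)
      fix a :: real assume "a < 0"
      hence "- a > 0" by simp
      with 3(2) have "\<forall>\<^sub>F t in at_top. - x t / y t < - a" by blast
      thus "\<forall>\<^sub>F t in at_top. x t / y t > a" by eventually_elim simp
    qed (use 3(1) in blast)
    thus ?thesis by blast
  qed blast
qed

theorem theorem7:
  fixes f g x :: "real \<Rightarrow> real" and \<beta> \<xi> :: real
  assumes f_cont: "continuous_on UNIV f"
    and f_zero: "f 0 = 0"
    and f_sign: "\<And>y. y \<noteq> 0 \<Longrightarrow> y * f y > 0"
    and f_odd: "\<exists>\<phi> :: real \<Rightarrow> real. (\<forall>y. \<phi> (- y) = - \<phi> y) \<and> ((\<lambda>y. f y / \<phi> y) \<longlongrightarrow> 1) (at 0)"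
    and beta: "\<beta> > 1"
    and f_RV: "regularly_varying_at_0 \<beta> f"
    and f_sublin: "((\<lambda>y. f y / y) \<longlongrightarrow> 0) (at_right 0)"
    and g_cont: "continuous_on {0..} g"
    and x_cont: "continuous_on {0..} x"
    and x_ode: "\<And>t. t > 0 \<Longrightarrow> (x has_real_derivative (- f (x t) + g t)) (at t)"
    and x_init: "x 0 = \<xi>"
    and x_lim: "(x \<longlongrightarrow> 0) at_top"
  shows "((\<lambda>t. g t / f (recip_integral_inv f t)) \<longlongrightarrow> 0) at_top \<longleftrightarrow>
    (\<exists>c\<in>{-1, 0, 1 :: real}.
       ((\<lambda>t. x t / recip_integral_inv f t) \<longlongrightarrow> c) at_top \<and>
       ((\<lambda>t. deriv x t / f (recip_integral_inv f t)) \<longlongrightarrow> - c) at_top)"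
proof -
  define y where "y = recip_integral_inv f"
  have pos: "f u > 0" if "u > 0" for u
    using f_sign[of u] that by (simp add: zero_less_mult_iff)
  have nonpos: "f u \<le> 0" if "u < 0" for u
    using f_sign[of u] that by (simp add: zero_less_mult_iff)
  have cont: "continuous_on {0<..} f" by (rule continuous_on_subset[OF f_cont]) simp
  have y_pos: "y t > 0" if "t > 0" for t
    using recip_integral_inv_pos[OF cont pos f_sublin] that by (simp add: y_def)
  have y_ev: "\<forall>\<^sub>F t in at_top. y t > 0"
    using eventually_gt_at_top[of 0] by eventually_elim (rule y_pos)
  have y_ode: "(y has_real_derivative - f (y t)) (at t)" if "t > 0" for t
    unfolding y_def by (rule recip_integral_inv_deriv[OF cont pos f_sublin that])
  have y_lim: "(y \<longlongrightarrow> 0) at_top"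
    unfolding y_def by (rule recip_integral_inv_tendsto_0[OF cont pos f_sublin])
  have refl: "((\<lambda>y. - f (- y) / f y) \<longlongrightarrow> 1) (at_right 0)"
    using f_odd asymptotically_odd_reflection
    by (blast intro: filterlim_mono[OF _ order_refl at_le] tendsto_within_subset)
  have deriv_x: "\<forall>\<^sub>F t in at_top. deriv x t / f (y t) = g t / f (y t) - f (x t) / f (y t)"
    using eventually_gt_at_top[of 0]
    by eventually_elim (simp add: DERIV_imp_deriv[OF x_ode] diff_divide_distrib)
  have f_ratio: "((\<lambda>t. f (x t) / f (y t)) \<longlongrightarrow> c) at_top"
    if "c \<in> {-1, 0, 1}" "((\<lambda>t. x t / y t) \<longlongrightarrow> c) at_top" for c
    by (rule regularly_varying_ratio_limit[OF f_cont f_zero nonpos f_RV beta refl y_lim y_ev that(2,1)])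
  have "((\<lambda>t. g t / f (y t)) \<longlongrightarrow> 0) at_top \<longleftrightarrow>
    (\<exists>c\<in>{-1, 0, 1}. ((\<lambda>t. x t / y t) \<longlongrightarrow> c) at_top \<and>
       ((\<lambda>t. deriv x t / f (y t)) \<longlongrightarrow> - c) at_top)"
  proof
    assume g_lim: "((\<lambda>t. g t / f (y t)) \<longlongrightarrow> 0) at_top"
    obtain c where c: "c \<in> {-1, 0, 1}" "((\<lambda>t. x t / y t) \<longlongrightarrow> c) at_top"
      using perturbed_ratio_limit[OF f_cont f_RV beta refl y_lim y_pos y_ode x_lim x_ode g_lim] by blast
    have "((\<lambda>t. g t / f (y t) - f (x t) / f (y t)) \<longlongrightarrow> 0 - c) at_top"
      by (intro tendsto_diff g_lim f_ratio c)
    hence "((\<lambda>t. deriv x t / f (y t)) \<longlongrightarrow> - c) at_top"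
      using deriv_x by (simp add: tendsto_cong)
    with c show "\<exists>c\<in>{-1, 0, 1}. ((\<lambda>t. x t / y t) \<longlongrightarrow> c) at_top \<and>
       ((\<lambda>t. deriv x t / f (y t)) \<longlongrightarrow> - c) at_top" by blast
  next
    assume "\<exists>c\<in>{-1, 0, 1}. ((\<lambda>t. x t / y t) \<longlongrightarrow> c) at_top \<and>
       ((\<lambda>t. deriv x t / f (y t)) \<longlongrightarrow> - c) at_top"
    then obtain c where c: "c \<in> {-1, 0, 1}" "((\<lambda>t. x t / y t) \<longlongrightarrow> c) at_top"
      and x': "((\<lambda>t. deriv x t / f (y t)) \<longlongrightarrow> - c) at_top" by blast
    have "((\<lambda>t. deriv x t / f (y t) + f (x t) / f (y t)) \<longlongrightarrow> - c + c) at_top"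
      by (intro tendsto_add x' f_ratio c)
    moreover have "\<forall>\<^sub>F t in at_top. deriv x t / f (y t) + f (x t) / f (y t) = g t / f (y t)"
      using deriv_x by eventually_elim simp
    ultimately show "((\<lambda>t. g t / f (y t)) \<longlongrightarrow> 0) at_top"
      by (simp add: tendsto_cong)
  qed
  thus ?thesis by (simp only: y_def)
qed

end
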